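(* For every $n\ge 1$, $$|\mathcal{RS}_n(312)|=2^{n-1},$$ i.e. there are exactly $2^{n-1}$ simsun permutations of length $n$ that avoid the pattern $312$.
   Context: $\mathfrak{S}_n$ is the set of permutations of $\{1,\dots,n\}$, written in one-line notation $\pi=\pi_1\pi_2\dots\pi_n$. A permutation $\pi\in\mathfrak{S}_n$ is simsun if for every $3\le k\le n$, the subword of $\pi_1\pi_2\dots\pi_n$ consisting of the entries in $\{1,\dots,k\}$ (kept in their order) has no double descent, i.e. no three entries that are consecutive in that subword and in decreasing order. A permutation $\pi\in\mathfrak{S}_n$ avoids the pattern $\sigma\in\mathfrak{S}_k$ if there are no indices $i_1<i_2<\dots<i_k$ such that $\pi_{i_1}\pi_{i_2}\dots\pi_{i_k}$ is in the same relative order as $\sigma$. $\mathcal{RS}_n(\sigma)$ is the set of simsun permutations in $\mathfrak{S}_n$ avoiding $\sigma$. *)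

theory Defs
  imports "HOL-Combinatorics.Multiset_Permutations"
begin

text \<open>
  A permutation of \<open>{1..n}\<close> in one-line notation is a list of natural numbers in
  \<open>permutations_of_set {1..n}\<close>. The values are \<open>1, \<dots>, n\<close> while
  list positions count from \<open>0\<close>.
\<close>

definition has_double_descent :: "nat list \<Rightarrow> bool" where
  "has_double_descent w \<longleftrightarrow>
     (\<exists>i. i + 2 < length w \<and> w ! i > w ! (i + 1) \<and> w ! (i + 1) > w ! (i + 2))"

definition restrict_word :: "nat \<Rightarrow> nat list \<Rightarrow> nat list" where
  "restrict_word k w = filter (\<lambda>x. x \<in> {1..k}) w"

definition simsun :: "nat list \<Rightarrow> bool" where
  "simsun w \<longleftrightarrow> (\<forall>k. 3 \<le> k \<and> k \<le> length w \<longrightarrow> \<not> has_double_descent (restrict_word k w))"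

definition contains_pattern :: "nat list \<Rightarrow> nat list \<Rightarrow> bool" where
  "contains_pattern w p \<longleftrightarrow>
     (\<exists>f. strict_mono_on {..<length p} f \<and>
          (\<forall>a<length p. f a < length w) \<and>
          (\<forall>a<length p. \<forall>b<length p. w ! f a < w ! f b \<longleftrightarrow> p ! a < p ! b))"

definition avoids :: "nat list \<Rightarrow> nat list \<Rightarrow> bool" where
  "avoids w p \<longleftrightarrow> \<not> contains_pattern w p"

definition RS :: "nat \<Rightarrow> nat list \<Rightarrow> nat list set" where
  "RS n p = {w \<in> permutations_of_set {1..n}. simsun w \<and> avoids w p}"

end

theory Submission
  imports Defs "HOL-Library.Sublist"
begin

text \<open>
  The count doubles with each new maximum. Deleting the largest entry from a simsun permutation
  that avoids \<open>312\<close> leaves a simsun permutation that avoids \<open>312\<close>, so it is enough to see where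
  the maximum \<open>m\<close> may be inserted. If two entries followed it, say \<open>m a b\<close> with \<open>a\<close> and \<open>b\<close>
  adjacent, then \<open>a < b\<close> would make \<open>m a b\<close> an occurrence of \<open>312\<close>, and \<open>a > b\<close> would make it a
  double descent. Hence \<open>m\<close> is in the last place or in the last but one. Conversely both places
  are harmless: in a \<open>312\<close> or in a double descent \<open>m\<close> can only be the first and largest entry,
  and then two more entries would have to follow it. Since the two places are distinct as soon as
  the shorter permutation is nonempty, each of its extensions is counted exactly once and there
  are two of them. Lemma \<open>insert_max_in_RS_iff\<close> is this argument.
\<close>

text \<open>
  Occurrences are expressed by the orders \<open>sublist\<close> and \<open>subseq\<close> on lists, so that their
  behaviour under inserting an entry comes from list lemmas instead of shifts of positions.
\<close>

lemma has_double_descent_iff_sublist: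
  "has_double_descent w \<longleftrightarrow> (\<exists>c b a. sublist [c, b, a] w \<and> a < b \<and> b < c)"
proof
  assume "has_double_descent w"
  then obtain i where i: "i + 2 < length w" "w ! i > w ! (i + 1)" "w ! (i + 1) > w ! (i + 2)"
    unfolding has_double_descent_def by blast
  have "drop i w = w ! i # w ! (i + 1) # w ! (i + 2) # drop (i + 3) w"
    using i(1) by (simp add: Cons_nth_drop_Suc numeral_3_eq_3)
  then have "w = take i w @ [w ! i, w ! (i + 1), w ! (i + 2)] @ drop (i + 3) w"
    by (metis append_Cons append_Nil append_take_drop_id)
  then have "sublist [w ! i, w ! (i + 1), w ! (i + 2)] w"
    unfolding sublist_def by blast
  with i show "\<exists>c b a. sublist [c, b, a] w \<and> a < b \<and> b < c" by blast
next
  assume "\<exists>c b a. sublist [c, b, a] w \<and> a < b \<and> b < c"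
  then obtain c b a xs ys where "w = xs @ [c, b, a] @ ys" "a < b" "b < c"
    unfolding sublist_def by blast
  then show "has_double_descent w"
    unfolding has_double_descent_def by (intro exI[of _ "length xs"]) (auto simp: nth_append)
qed

lemma subseq_3_iff_nth:
  "subseq [x, y, z] w \<longleftrightarrow>
     (\<exists>i j k. i < j \<and> j < k \<and> k < length w \<and> w ! i = x \<and> w ! j = y \<and> w ! k = z)"
proof
  assume "subseq [x, y, z] w"
  then obtain as bs cs ds where w: "w = as @ x # bs @ y # cs @ z # ds"
    by (auto dest!: list_emb_ConsD)
  show "\<exists>i j k. i < j \<and> j < k \<and> k < length w \<and> w ! i = x \<and> w ! j = y \<and> w ! k = z"
    unfolding w
    by (intro exI[of _ "length as"] exI[of _ "length as + 1 + length bs"]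
          exI[of _ "length as + 1 + length bs + 1 + length cs"])
       (simp add: nth_append)
next
  assume "\<exists>i j k. i < j \<and> j < k \<and> k < length w \<and> w ! i = x \<and> w ! j = y \<and> w ! k = z"
  then obtain i j k where ijk: "i < j" "j < k" "k < length w" "w ! i = x" "w ! j = y" "w ! k = z"
    by blast
  have "subseq [z] (drop (Suc j) w)"
    using ijk nth_mem[of "k - Suc j" "drop (Suc j) w"] by (simp add: subseq_singleton_left)
  then have "subseq [y, z] (drop j w)"
    using ijk Cons_nth_drop_Suc[of j w] by (metis less_trans subseq_Cons2)
  moreover have "subseq (drop j w) (drop (Suc i) w)"
    using suffix_drop[of "j - Suc i" "drop (Suc i) w"] ijk(1) by (simp add: suffix_imp_subseq)
  ultimately have "subseq [y, z] (drop (Suc i) w)"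
    by (rule subseq_order.trans)
  then have "subseq [x, y, z] (drop i w)"
    using ijk Cons_nth_drop_Suc[of i w] by (metis less_trans subseq_Cons2)
  then show "subseq [x, y, z] w"
    by (metis append_take_drop_id list_emb_append2)
qed

lemma contains_312_iff_subseq:
  "contains_pattern w [3, 1, 2] \<longleftrightarrow> (\<exists>c a b. subseq [c, a, b] w \<and> a < b \<and> b < c)"
proof
  assume "contains_pattern w [3, 1, 2]"
  then obtain f where f: "strict_mono_on {..<3} f" "\<forall>a<3. f a < length w"
    "\<forall>a<3. \<forall>b<3. w ! f a < w ! f b \<longleftrightarrow> [3, 1, 2::nat] ! a < [3, 1, 2] ! b"
    unfolding contains_pattern_def by (auto simp: numeral_3_eq_3)
  have "f 0 < f 1" "f 1 < f 2"
    using f(1) by (auto simp: strict_mono_on_def)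
  moreover have "f 2 < length w" "w ! f 1 < w ! f 2" "w ! f 2 < w ! f 0"
    using f(2,3) by auto
  ultimately show "\<exists>c a b. subseq [c, a, b] w \<and> a < b \<and> b < c"
    unfolding subseq_3_iff_nth by blast
next
  assume "\<exists>c a b. subseq [c, a, b] w \<and> a < b \<and> b < c"
  then obtain i j k where ijk: "i < j" "j < k" "k < length w" "w ! j < w ! k" "w ! k < w ! i"
    unfolding subseq_3_iff_nth by blast
  have "strict_mono_on {..<length [3, 1, 2::nat]} (\<lambda>a. [i, j, k] ! a)"
    using ijk by (auto simp: strict_mono_on_def less_Suc_eq)
  moreover have "\<forall>a<length [3, 1, 2::nat]. [i, j, k] ! a < length w"
    using ijk by (auto simp: less_Suc_eq)
  moreover have "\<forall>a<length [3, 1, 2::nat]. \<forall>b<length [3, 1, 2::nat].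
      w ! ([i, j, k] ! a) < w ! ([i, j, k] ! b) \<longleftrightarrow> [3, 1, 2::nat] ! a < [3, 1, 2] ! b"
    using ijk by (auto simp: less_Suc_eq)
  ultimately show "contains_pattern w [3, 1, 2]"
    unfolding contains_pattern_def by blast
qed

lemma restrict_word_perm:
  assumes "w \<in> permutations_of_set {1..n}"
  shows "restrict_word n w = w"
  using assms by (auto simp: restrict_word_def permutations_of_set_def intro!: filter_True)

text \<open>
  The definition of \<open>simsun\<close> is silent about words of length less than \<open>3\<close>, but these are too short
  for a double descent; in a longer word the case \<open>k = n\<close> concerns the whole word.
\<close>

lemma simsun_imp_no_double_descent:
  assumes "simsun w" and perm: "w \<in> permutations_of_set {1..n}"
  shows "\<not> has_double_descent w"
proof
  assume dd: "has_double_descent w"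
  then have "3 \<le> length w"
    by (auto simp: has_double_descent_def)
  moreover have "length w = n"
    using length_finite_permutations_of_set[OF perm] by simp
  ultimately show False
    using assms(1) dd restrict_word_perm[OF perm] by (auto simp: simsun_def)
qed

lemma insert_max_perm_iff:
  assumes "Suc n \<notin> set (u @ v)"
  shows "u @ Suc n # v \<in> permutations_of_set {1..Suc n} \<longleftrightarrow> u @ v \<in> permutations_of_set {1..n}"
proof -
  have "insert (Suc n) (set (u @ v)) = {1..Suc n} \<longleftrightarrow> set (u @ v) = {1..n}"
    using assms insert_ident[of "Suc n" "set (u @ v)" "{1..n}"] by (simp add: atLeastAtMostSuc_conv)
  then show ?thesis
    using assms by (auto simp: permutations_of_set_def)
qed

text \<open>
  Only the whole word gives a new condition, because the shorter words obtained from the longer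
  permutation by restriction do not contain the maximum.
\<close>

lemma simsun_insert_max_iff:
  assumes perm: "u @ v \<in> permutations_of_set {1..n}"
  shows "simsun (u @ Suc n # v) \<longleftrightarrow> simsun (u @ v) \<and> \<not> has_double_descent (u @ Suc n # v)"
proof -
  let ?w = "u @ Suc n # v"
  have perm': "?w \<in> permutations_of_set {1..Suc n}"
    using perm insert_max_perm_iff[of n u v] by (auto simp: permutations_of_set_def)
  have len: "length (u @ v) = n" "length ?w = Suc n"
    using length_finite_permutations_of_set[OF perm] by simp_all
  have restr: "restrict_word k ?w = restrict_word k (u @ v)" if "k \<le> n" for k
    using that by (simp add: restrict_word_def)
  show ?thesis
  proof
    assume s: "simsun ?w"
    then have "simsun (u @ v)"
      using len restr by (metis le_SucI simsun_def)
    with s show "simsun (u @ v) \<and> \<not> has_double_descent ?w"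
      using simsun_imp_no_double_descent perm' by blast
  next
    assume "simsun (u @ v) \<and> \<not> has_double_descent ?w"
    then show "simsun ?w"
      using len restr restrict_word_perm[OF perm'] by (metis le_SucE simsun_def)
  qed
qed

lemma insert_max_in_RS_iff:
  assumes fresh: "Suc n \<notin> set (u @ v)"
  shows "u @ Suc n # v \<in> RS (Suc n) [3, 1, 2] \<longleftrightarrow> u @ v \<in> RS n [3, 1, 2] \<and> length v \<le> 1"
    (is "?w \<in> _ \<longleftrightarrow> _")
proof
  assume w: "?w \<in> RS (Suc n) [3, 1, 2]"
  then have perm: "u @ v \<in> permutations_of_set {1..n}"
    using insert_max_perm_iff[OF fresh] by (simp add: RS_def)
  have no_dd: "\<not> has_double_descent ?w" and simsun: "simsun (u @ v)"
    using w simsun_insert_max_iff[OF perm] by (auto simp: RS_def)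
  have no_312: "\<not> (a < b \<and> b < c)" if "subseq [c, a, b] ?w" for a b c
    using w that unfolding RS_def avoids_def contains_312_iff_subseq by blast
  have "subseq (u @ v) ?w"
    by (intro list_emb_append_mono) auto
  then have "avoids (u @ v) [3, 1, 2]"
    unfolding avoids_def contains_312_iff_subseq using no_312 subseq_order.trans by blast
  moreover have "length v \<le> 1"
  proof (rule ccontr)
    assume "\<not> length v \<le> 1"
    then obtain a b v' where v: "v = a # b # v'"
      by (cases v rule: remdups_adj.cases) auto
    have "{a, b} \<subseteq> set (u @ v)" "a \<noteq> b"
      using perm by (auto simp: v permutations_of_set_def)
    then have "a \<noteq> b" "a < Suc n" "b < Suc n"
      using permutations_of_setD(1)[OF perm] by (simp_all del: set_append)
    moreover have "subseq [Suc n, a, b] ?w"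
      using v by (intro list_emb_append2) simp
    moreover have "sublist [Suc n, a, b] ?w"
      unfolding sublist_def v by (intro exI[of _ u] exI[of _ v']) simp
    ultimately show False
      using no_312 no_dd has_double_descent_iff_sublist by (metis linorder_neqE_nat)
  qed
  ultimately show "u @ v \<in> RS n [3, 1, 2] \<and> length v \<le> 1"
    using perm simsun by (simp add: RS_def)
next
  assume "u @ v \<in> RS n [3, 1, 2] \<and> length v \<le> 1"
  then have perm: "u @ v \<in> permutations_of_set {1..n}" and simsun: "simsun (u @ v)"
    and avoids: "avoids (u @ v) [3, 1, 2]" and v: "length v \<le> 1"
    by (auto simp: RS_def)
  have small: "x \<le> Suc n" if "x \<in> set ?w" for x
  proof -
    have "set ?w = insert (Suc n) {1..n}"
      using perm by (simp add: permutations_of_set_def)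
    then show ?thesis using that by auto
  qed
  have small_uv: "x \<noteq> Suc n" if "x \<in> set (u @ v)" for x
    using that fresh by blast
  have "\<not> has_double_descent ?w"
  proof
    assume "has_double_descent ?w"
    then obtain c b a where cba: "sublist [c, b, a] ?w" "a < b" "b < c"
      unfolding has_double_descent_iff_sublist by blast
    then have "c \<le> Suc n"
      using small set_mono_sublist[OF cba(1)] by simp
    \<comment> \<open>The maximum is neither \<open>a\<close> nor \<open>b\<close>, and too few entries follow it for it to be \<open>c\<close>.\<close>
    then have "sublist [c, b, a] u"
    proof (cases v)
      case Nil
      then show ?thesis using cba \<open>c \<le> Suc n\<close> sublist_snoc[of "[c, b, a]" u] by auto
    next
      case (Cons x xs)
      then have "?w = (u @ [Suc n]) @ [x]" using v by simp
      then have "sublist [c, b, a] (u @ [Suc n]) \<or> suffix ([c, b] @ [a]) ((u @ [Suc n]) @ [x])"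
        using cba(1) sublist_snoc[of "[c, b, a]" "u @ [Suc n]" x] by auto
      then have "sublist [c, b, a] (u @ [Suc n]) \<or> suffix ([c] @ [b]) (u @ [Suc n])"
        unfolding snoc_suffix_snoc by auto
      then have "sublist [c, b, a] (u @ [Suc n]) \<or> b = Suc n"
        unfolding snoc_suffix_snoc by blast
      then show ?thesis
        using cba \<open>c \<le> Suc n\<close> sublist_snoc[of "[c, b, a]" u] by auto
    qed
    then have "sublist [c, b, a] (u @ v)"
      by (simp add: sublist_append)
    then have "has_double_descent (u @ v)"
      using cba unfolding has_double_descent_iff_sublist by blast
    then show False
      using simsun_imp_no_double_descent[OF simsun perm] by simp
  qed
  moreover have "avoids ?w [3, 1, 2]"
    unfolding avoids_def contains_312_iff_subseq
  proof safe
    fix c a b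
    assume cab: "subseq [c, a, b] ?w" "a < b" "b < c"
    have c: "c \<le> Suc n"
      using small list_emb_set[OF cab(1), of c] by auto
    show False
    proof (cases "c = Suc n")
      case True
      have "subseq [Suc n, a, b] (Suc n # v)"
        using cab(1) True fresh by (induction u) auto
      then have "length [a, b] \<le> length v"
        by (metis list_emb_length subseq_Cons2_iff)
      with v show False by simp
    next
      case False
      \<comment> \<open>All three entries differ from the maximum and survive its deletion.\<close>
      have "subseq (filter (\<lambda>x. x \<noteq> Suc n) [c, a, b]) (filter (\<lambda>x. x \<noteq> Suc n) ?w)"
        using cab(1) by (rule subseq_filter)
      moreover have "filter (\<lambda>x. x \<noteq> Suc n) ?w = u @ v"
        using small_uv by (simp add: filter_True)
      ultimately have "subseq [c, a, b] (u @ v)"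
        using c cab False by simp
      then show False
        using avoids cab unfolding avoids_def contains_312_iff_subseq by blast
    qed
  qed
  ultimately show "?w \<in> RS (Suc n) [3, 1, 2]"
    using perm simsun simsun_insert_max_iff[OF perm] insert_max_perm_iff[OF fresh]
    by (simp add: RS_def)
qed

lemma RS_1: "RS 1 [3, 1, 2] = {[1]}"
proof -
  have "avoids [1] [3, 1, 2]"
    unfolding avoids_def contains_312_iff_subseq by auto
  then show ?thesis
    by (auto simp: RS_def simsun_def)
qed

text \<open>
  The new maximum goes either after the last entry or just before it. The two images are disjoint
  since only the words in the first one end with the maximum.
\<close>

lemma card_RS_Suc:
  assumes "n \<ge> 1"
  shows "card (RS (Suc n) [3, 1, 2]) = 2 * card (RS n [3, 1, 2])"
proof -
  let ?R = "RS n [3, 1, 2]"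
  define f where "f w = w @ [Suc n]" for w
  define g where "g w = butlast w @ [Suc n, last w]" for w
  have set_R: "set w = {1..n}" if "w \<in> ?R" for w
    using that by (auto simp: RS_def permutations_of_set_def)
  have ne: "w \<noteq> []" if "w \<in> ?R" for w
    using set_R[OF that] assms by auto
  have split: "butlast w @ [last w] = w" if "w \<in> ?R" for w
    using ne[OF that] by simp
  have "RS (Suc n) [3, 1, 2] = f ` ?R \<union> g ` ?R"
  proof (intro equalityI subsetI)
    fix w assume w: "w \<in> RS (Suc n) [3, 1, 2]"
    then have "Suc n \<in> set w" "distinct w"
      by (auto simp: RS_def permutations_of_set_def)
    then obtain u v where uv: "w = u @ Suc n # v" "Suc n \<notin> set (u @ v)"
      by (auto dest: split_list)
    then have R: "u @ v \<in> ?R" "length v \<le> 1"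
      using w insert_max_in_RS_iff by blast+
    then consider "v = []" | x where "v = [x]"
      by (cases v) auto
    then show "w \<in> f ` ?R \<union> g ` ?R"
    proof cases
      case 1
      then have "w = f (u @ v)" by (simp add: uv f_def)
      with R show ?thesis by blast
    next
      case 2
      then have "w = g (u @ v)" by (simp add: uv g_def butlast_append)
      with R show ?thesis by blast
    qed
  next
    fix w assume "w \<in> f ` ?R \<union> g ` ?R"
    then obtain x where x: "x \<in> ?R" "w = f x \<or> w = g x" by blast
    have "Suc n \<notin> set x" using set_R[OF x(1)] by simp
    then show "w \<in> RS (Suc n) [3, 1, 2]"
      using x insert_max_in_RS_iff[of n x "[]"] insert_max_in_RS_iff[of n "butlast x" "[last x]"]
        split[OF x(1)]
      by (auto simp: f_def g_def)
  qed
  moreover have "f ` ?R \<inter> g ` ?R = {}"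
  proof -
    have "last x \<noteq> Suc n" if "x \<in> ?R" for x
      using last_in_set[OF ne[OF that]] set_R[OF that] by auto
    moreover have "last (f x) = Suc n" "last (g x) = last x" for x
      by (simp_all add: f_def g_def)
    ultimately have "f x \<noteq> g y" if "y \<in> ?R" for x y
      using that by metis
    then show ?thesis
      by blast
  qed
  moreover have "inj_on f ?R"
    by (auto simp: inj_on_def f_def)
  moreover have "inj_on g ?R"
  proof (rule inj_onI)
    fix x y assume xy: "x \<in> ?R" "y \<in> ?R" "g x = g y"
    from xy(3) have "butlast x = butlast y" "last x = last y"
      by (simp_all add: g_def)
    then show "x = y"
      using split[OF xy(1)] split[OF xy(2)] by metis
  qed
  moreover have "finite ?R"
    by (simp add: RS_def)
  ultimately show ?thesis
    by (simp add: card_Un_disjoint card_image)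
qed

theorem proposition6p1:
  fixes n :: nat
  assumes "n \<ge> 1"
  shows "card (RS n [3, 1, 2]) = 2 ^ (n - 1)"
  using assms
proof (induction n rule: nat_induct_at_least)
  case base
  show ?case using RS_1 by simp
next
  case (Suc n)
  then show ?case
    using card_RS_Suc[of n] by (cases n) simp_all
qed

end
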